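(* On a CAT(1) space $X$, suppose the evader wins a discrete-time simple pursuit with initial distance $L_0=d(P_0,E_0)<\pi$. Then the total curvature $\tau(t)$ of the pursuit curve from $P(0)$ to $P(t)$ is $O(t^{1/2})$ as $t\to\infty$.
   Context: A CAT(1) space is a metric space $(X,d)$ in which any two points at distance $<\pi$ are joined by a geodesic, and in which the distance between any two points of any geodesic triangle of perimeter $<2\pi$ is at most the distance between the corresponding points of the triangle with the same sidelengths in the unit 2-sphere. (Geodesics between points at distance $<\pi$ are then unique.) The angle in $[0,\pi]$ between two geodesic segments from a common point is the limit (= infimum) of the corresponding angles in model triangles for initial subsegments. Discrete-time simple pursuit with step size $D>0$: a pursuer $P$ and an evader $E$ start at $P_0,E_0\in X$. At the $i$-th step ($i\ge1$) the evader moves from $E_{i-1}$ to a point $E_i$ of its choice with $d(E_{i-1},E_i)\le D$, and the pursuer moves to $P_i$, the point at distance $D$ from $P_{i-1}$ on the geodesic from $P_{i-1}$ to $E_{i-1}$. Play ends with a win for the pursuer if $d(P_i,E_i)\le D$ for some $i$. The sequence $L_i=d(P_i,E_i)$ is non-increasing. The evader wins if and only if play continues forever and $\lim_{i\to\infty}L_i>D$. The pursuit curve $P(t)$ is the unit-speed curve obtained by joining the successive $P_i$ by geodesic segments, so $P(iD)=P_i$. The total curvature of $P|_{[0,t]}$ is $\tau(t)=\sum_i(\pi-\beta_i)$, where the $\beta_i$ are the angles at the interior vertices of this piecewise-geodesic curve. *)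

theory Defs
  imports "HOL-Analysis.Analysis" "HOL-Library.Landau_Symbols"
begin

section \<open>Geodesics and the unit 2-sphere\<close>

text \<open>Only the values of \<open>c\<close> on \<open>{0..dist x y}\<close> matter.\<close>

definition is_geodesic :: "(real \<Rightarrow> 'a::metric_space) \<Rightarrow> 'a \<Rightarrow> 'a \<Rightarrow> bool" where
  "is_geodesic c x y \<longleftrightarrow> c 0 = x \<and> c (dist x y) = y \<and>
     (\<forall>s\<in>{0..dist x y}. \<forall>t\<in>{0..dist x y}. dist (c s) (c t) = \<bar>s - t\<bar>)"

abbreviation S2 :: "(real^3) set" where
  "S2 \<equiv> sphere 0 1"

definition sphere_dist :: "real^3 \<Rightarrow> real^3 \<Rightarrow> real" where
  "sphere_dist u v = arccos (u \<bullet> v)"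

text \<open>The angle at \<open>p\<close> is measured between the initial directions of the great circle arcs
  from \<open>p\<close> to \<open>q\<close> and to \<open>r\<close>, which are the normalised projections of \<open>q\<close> and \<open>r\<close> to the
  tangent plane at \<open>p\<close>. It is meaningful if neither \<open>q\<close> nor \<open>r\<close> equals \<open>p\<close> or its antipode.\<close>

definition sphere_angle :: "real^3 \<Rightarrow> real^3 \<Rightarrow> real^3 \<Rightarrow> real" where
  "sphere_angle p q r =
     arccos (sgn (q - (p \<bullet> q) *\<^sub>R p) \<bullet> sgn (r - (p \<bullet> r) *\<^sub>R p))"

definition comparison_triangle ::
    "'a::metric_space \<Rightarrow> 'a \<Rightarrow> 'a \<Rightarrow> real^3 \<Rightarrow> real^3 \<Rightarrow> real^3 \<Rightarrow> bool" where
  "comparison_triangle x y z x' y' z' \<longleftrightarrow> x' \<in> S2 \<and> y' \<in> S2 \<and> z' \<in> S2 \<and>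
     sphere_dist x' y' = dist x y \<and> sphere_dist y' z' = dist y z \<and> sphere_dist z' x' = dist z x"

section \<open>CAT(1) spaces\<close>

text \<open>The point \<open>p\<close> of the side \<open>c\<close> from \<open>x\<close> to \<open>y\<close> corresponds to the point \<open>p'\<close> of the
  spherical segment from \<open>x'\<close> to \<open>y'\<close>. The two distance equations say that \<open>p'\<close> lies on
  this segment; they determine \<open>p'\<close> if \<open>sphere_dist x' y' = dist x y < pi\<close>.\<close>

definition corresponds_on_side ::
    "(real \<Rightarrow> 'a::metric_space) \<Rightarrow> 'a \<Rightarrow> 'a \<Rightarrow> real^3 \<Rightarrow> real^3 \<Rightarrow> 'a \<Rightarrow> real^3 \<Rightarrow> bool" where
  "corresponds_on_side c x y x' y' p p' \<longleftrightarrow>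
     (\<exists>s\<in>{0..dist x y}. p = c s \<and> p' \<in> S2 \<and>
        sphere_dist x' p' = s \<and> sphere_dist p' y' = dist x y - s)"

class cat1_space = metric_space +
  assumes cat1_geodesic: "dist x y < pi \<Longrightarrow> \<exists>c. is_geodesic c x y"
    and cat1_comparison:
      "\<lbrakk>is_geodesic a x y; is_geodesic b y z; is_geodesic c z x;
        dist x y + dist y z + dist z x < 2 * pi;
        comparison_triangle x y z x' y' z';
        corresponds_on_side a x y x' y' p p' \<or> corresponds_on_side b y z y' z' p p' \<or>
          corresponds_on_side c z x z' x' p p';
        corresponds_on_side a x y x' y' q q' \<or> corresponds_on_side b y z y' z' q q' \<or>
          corresponds_on_side c z x z' x' q q'\<rbrakk>
       \<Longrightarrow> dist p q \<le> sphere_dist p' q'"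

text \<open>The value \<open>model_angle p x y\<close>, the angle at the vertex corresponding to \<open>p\<close>, is well defined
  if \<open>dist p x\<close> and \<open>dist p y\<close> lie strictly between \<open>0\<close> and \<open>pi\<close> and the perimeter is less
  than \<open>2 * pi\<close>, because spherical triangles are determined up to congruence by their sides.\<close>

definition model_angle :: "'a::metric_space \<Rightarrow> 'a \<Rightarrow> 'a \<Rightarrow> real" where
  "model_angle p x y =
     (THE \<theta>. \<exists>p' x' y'. comparison_triangle p x y p' x' y' \<and> \<theta> = sphere_angle p' x' y')"

text \<open>Here \<open>c\<close> and \<open>c'\<close> are nonconstant unit-speed geodesics issuing from \<open>c 0 = c' 0\<close>.
  Because of the limit only their initial parts matter.\<close>

definition geodesic_angle :: "(real \<Rightarrow> 'a::metric_space) \<Rightarrow> (real \<Rightarrow> 'a) \<Rightarrow> real" where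
  "geodesic_angle c c' =
     Lim (at_right 0 \<times>\<^sub>F at_right 0) (\<lambda>(s, t). model_angle (c 0) (c s) (c' t))"

section \<open>Discrete-time simple pursuit\<close>

text \<open>A play that continues forever. The condition \<open>D \<le> dist (P i) (E i)\<close> ensures that the
  geodesic to the evader contains a point at distance \<open>D\<close> from the pursuer.\<close>

definition simple_pursuit ::
    "real \<Rightarrow> (nat \<Rightarrow> 'a::metric_space) \<Rightarrow> (nat \<Rightarrow> 'a) \<Rightarrow> bool" where
  "simple_pursuit D P E \<longleftrightarrow>
     (\<forall>i. dist (E i) (E (Suc i)) \<le> D \<and> D \<le> dist (P i) (E i) \<and>
        (\<exists>c. is_geodesic c (P i) (E i) \<and> P (Suc i) = c D))"

definition evader_wins ::
    "real \<Rightarrow> (nat \<Rightarrow> 'a::metric_space) \<Rightarrow> (nat \<Rightarrow> 'a) \<Rightarrow> bool" where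
  "evader_wins D P E \<longleftrightarrow> simple_pursuit D P E \<and>
     (\<forall>i. dist (P i) (E i) > D) \<and>
     (\<exists>l. (\<lambda>i. dist (P i) (E i)) \<longlonglongrightarrow> l \<and> l > D)"

text \<open>In a pursuit the distance from \<open>P i\<close> to \<open>P (Suc i)\<close> is \<open>D\<close>, so \<open>c\<close> traverses the geodesic
  between them on \<open>{i * D..(i + 1) * D}\<close> and \<open>c (i * D) = P i\<close>.\<close>

definition pursuit_curve ::
    "real \<Rightarrow> (nat \<Rightarrow> 'a::metric_space) \<Rightarrow> (real \<Rightarrow> 'a) \<Rightarrow> bool" where
  "pursuit_curve D P c \<longleftrightarrow> (\<forall>i. is_geodesic (\<lambda>s. c (real i * D + s)) (P i) (P (Suc i)))"

text \<open>The total curvature of the restriction to \<open>{0..t}\<close> of a piecewise geodesic unit-speed curve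
  with vertices at the parameters \<open>i * D\<close>; the vertices at \<open>0\<close> and (possibly) \<open>t\<close> are not
  interior.\<close>

definition total_curvature :: "real \<Rightarrow> (real \<Rightarrow> 'a::metric_space) \<Rightarrow> real \<Rightarrow> real" where
  "total_curvature D c t =
     (\<Sum>i | 0 < i \<and> real i * D < t.
        pi - geodesic_angle (\<lambda>s. c (real i * D - s)) (\<lambda>s. c (real i * D + s)))"

end

theory Submission
  imports Defs
begin

text \<open>
  The turning angle of the pursuit curve at the vertex \<open>P (Suc i)\<close> is controlled by the progress
  \<open>L i - L (Suc i)\<close> which the pursuer makes in the corresponding step, where
  \<open>L i = dist (P i) (E i)\<close>. The vertex lies between \<open>P i\<close> and \<open>E i\<close> on a geodesic, and the pursuer
  leaves it towards \<open>E (Suc i)\<close>. Hence the turning angle is at most the angle at the vertex between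
  the directions of \<open>E i\<close> and \<open>E (Suc i)\<close>, and this in turn is at most the angle \<open>\<alpha>\<close> of the
  spherical triangle with the sides \<open>L i - D\<close> and \<open>L (Suc i)\<close> enclosing \<open>\<alpha>\<close> and an opposite side of
  length at most \<open>D\<close>. These two steps are contained in \<open>turning_angle_bound\<close>.

  By the spherical law of cosines \<open>1 - cos \<alpha>\<close> is at most \<open>L i - L (Suc i)\<close> divided by the product
  of the sines of the two enclosing sides. Since \<open>L\<close> decreases to a limit \<open>l > D\<close> and
  \<open>L 0 < pi\<close>, these sides stay in a compact part of \<open>(0, pi)\<close>, so that \<open>\<alpha>\<^sup>2\<close> is at most a constant
  times \<open>L i - L (Suc i)\<close>. The squares of the turning angles thus have a finite sum, by telescoping,
  and the Cauchy-Schwarz inequality bounds the sum of the first \<open>n\<close> turning angles by a constant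
  times \<open>sqrt n\<close>. Up to time \<open>t\<close> there are at most \<open>t / D\<close> vertices.

  On the side of CAT(1) geometry this needs that angles exist and do not exceed model angles
  (\<open>cos_model_antimono\<close>, \<open>geodesic_angle_bounds\<close>), and that the angles
  towards two points that lie on opposite sides of the vertex on a geodesic add up to at least \<open>pi\<close>. The latter is proved by a first variation argument
  (\<open>cos_model_opposite_le\<close>) rather than through a triangle inequality for angles.
\<close>

section \<open>Spherical trigonometry\<close>

text \<open>Polar coordinates around the pole \<open>polar 0 \<theta>\<close>, which does not depend on \<open>\<theta>\<close>. All comparison
  triangles are built with one vertex at the pole.\<close>

definition polar :: "real \<Rightarrow> real \<Rightarrow> real^3" where
  "polar r \<theta> = vector [cos r, sin r * cos \<theta>, sin r * sin \<theta>]"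

lemma inner_polar:
  "polar r \<theta> \<bullet> polar r' \<theta>' = cos r * cos r' + sin r * sin r' * cos (\<theta> - \<theta>')"
  by (simp add: polar_def inner_vec_def sum_3 cos_diff algebra_simps)

lemma polar_in_S2: "polar r \<theta> \<in> S2"
proof -
  have "polar r \<theta> \<bullet> polar r \<theta> = 1"
    by (simp add: inner_polar flip: power2_eq_square)
  then show ?thesis
    by (simp add: norm_eq_sqrt_inner)
qed

lemma sphere_dist_polar_same_ray:
  assumes "0 \<le> r" "r \<le> r'" "r' \<le> pi"
  shows "sphere_dist (polar r \<theta>) (polar r' \<theta>) = r' - r"
proof -
  have "polar r \<theta> \<bullet> polar r' \<theta> = cos (r' - r)"
    by (simp add: inner_polar cos_diff algebra_simps)
  then show ?thesis
    using assms by (simp add: sphere_dist_def arccos_cos)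
qed

lemma sphere_dist_commute: "sphere_dist u v = sphere_dist v u"
  by (simp add: sphere_dist_def inner_commute)

text \<open>The cosine of the angle of a spherical triangle enclosed by the sides \<open>a\<close> and \<open>b\<close> and
  opposite to \<open>d\<close>. Working with cosines keeps the comparison arguments rational in the cosines and
  sines of the sides; \<open>arccos\<close> is only applied at the end.\<close>

definition cos_angle_of_sides :: "real \<Rightarrow> real \<Rightarrow> real \<Rightarrow> real" where
  "cos_angle_of_sides a b d = (cos d - cos a * cos b) / (sin a * sin b)"

lemma cos_angle_of_sides_commute: "cos_angle_of_sides a b d = cos_angle_of_sides b a d"
  by (simp add: cos_angle_of_sides_def mult.commute)

lemma law_of_cosines:
  assumes "0 < a" "a < pi" "0 < b" "b < pi"
  shows "cos d = cos a * cos b + sin a * sin b * cos_angle_of_sides a b d"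
proof -
  have "sin a > 0" "sin b > 0"
    using assms by (auto intro: sin_gt_zero)
  then show ?thesis
    by (simp add: cos_angle_of_sides_def)
qed

text \<open>By the addition theorem the extreme values \<open>1\<close> and \<open>-1\<close> belong to the degenerate triangles
  with \<open>d = \<bar>a - b\<bar>\<close> and \<open>cos d = cos (a + b)\<close>. Monotonicity of the cosine on \<open>[0, pi]\<close> does the rest;
  if \<open>a + b > pi\<close> the perimeter bound replaces the triangle inequality.\<close>

lemma abs_cos_angle_of_sides_le_1:
  assumes "0 < a" "a < pi" "0 < b" "b < pi"
    and "\<bar>a - b\<bar> \<le> d" "d \<le> a + b" "a + b + d \<le> 2 * pi"
  shows "\<bar>cos_angle_of_sides a b d\<bar> \<le> 1"
proof -
  have s: "sin a * sin b > 0"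
    using assms by (simp add: sin_gt_zero)
  have "cos d \<le> cos \<bar>a - b\<bar>"
    using assms by (intro cos_monotone_0_pi_le) auto
  then have upper: "cos d - cos a * cos b \<le> sin a * sin b"
    by (simp add: cos_diff abs_if split: if_splits) (auto simp: cos_diff algebra_simps)
  have "cos (a + b) \<le> cos d"
  proof (cases "a + b \<le> pi")
    case True
    then show ?thesis
      using assms by (intro cos_monotone_0_pi_le) auto
  next
    case False
    have "cos (2 * pi - (a + b)) \<le> cos d"
      using assms False by (intro cos_monotone_0_pi_le) auto
    then show ?thesis
      by (simp add: cos_diff)
  qed
  then have lower: "- (sin a * sin b) \<le> cos d - cos a * cos b"
    by (simp add: cos_add)
  show ?thesis
    using s upper lower
    by (simp add: cos_angle_of_sides_def abs_le_iff divide_simps)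
qed

lemma cos_sphere_dist:
  assumes "u \<in> S2" "v \<in> S2"
  shows "cos (sphere_dist u v) = u \<bullet> v"
proof -
  have "\<bar>u \<bullet> v\<bar> \<le> 1"
    using Cauchy_Schwarz_ineq2[of u v] assms by simp
  then show ?thesis
    by (simp add: sphere_dist_def cos_arccos_abs)
qed

lemma norm_tangential_part:
  assumes "u \<in> S2" "v \<in> S2"
  shows "norm (v - (u \<bullet> v) *\<^sub>R u) = sin (sphere_dist u v)"
proof -
  have 1: "u \<bullet> u = 1" "v \<bullet> v = 1"
    using assms by (auto simp: dot_square_norm)
  have le: "\<bar>u \<bullet> v\<bar> \<le> 1"
    using Cauchy_Schwarz_ineq2[of u v] assms by simp
  have "(v - (u \<bullet> v) *\<^sub>R u) \<bullet> (v - (u \<bullet> v) *\<^sub>R u) = 1 - (u \<bullet> v)\<^sup>2"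
    using 1 by (simp add: algebra_simps inner_commute power2_eq_square)
  then show ?thesis
    using le by (simp add: norm_eq_sqrt_inner sphere_dist_def sin_arccos_abs)
qed

lemma sphere_angle_eq:
  assumes "p \<in> S2" "q \<in> S2" "r \<in> S2"
  shows "sphere_angle p q r =
    arccos (cos_angle_of_sides (sphere_dist p q) (sphere_dist p r) (sphere_dist q r))"
proof -
  have "p \<bullet> p = 1"
    using assms by (auto simp: dot_square_norm)
  then have "(q - (p \<bullet> q) *\<^sub>R p) \<bullet> (r - (p \<bullet> r) *\<^sub>R p) = q \<bullet> r - (p \<bullet> q) * (p \<bullet> r)"
    by (simp add: algebra_simps inner_commute)
  then show ?thesis
    using assms
    by (simp add: sphere_angle_def sgn_div_norm norm_tangential_part cos_angle_of_sides_def
        cos_sphere_dist divide_inverse mult_ac)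
qed

section \<open>Comparison triangles\<close>

text \<open>The triples for which \<open>model_angle p x y\<close> is well defined. By the triangle inequality the
  perimeter bound also makes every side shorter than \<open>pi\<close>.\<close>

definition hinge :: "'a::metric_space \<Rightarrow> 'a \<Rightarrow> 'a \<Rightarrow> bool" where
  "hinge p x y \<longleftrightarrow> p \<noteq> x \<and> p \<noteq> y \<and> dist p x + dist p y + dist x y < 2 * pi"

text \<open>The cosine of \<open>model_angle p x y\<close>, see \<open>model_angle_eq\<close> below.\<close>

definition cos_model :: "'a::metric_space \<Rightarrow> 'a \<Rightarrow> 'a \<Rightarrow> real" where
  "cos_model p x y = cos_angle_of_sides (dist p x) (dist p y) (dist x y)"

lemma hinge_commute: "hinge p x y \<longleftrightarrow> hinge p y x"
  by (auto simp: hinge_def dist_commute)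

lemma cos_model_commute: "cos_model p x y = cos_model p y x"
  by (simp add: cos_model_def dist_commute cos_angle_of_sides_commute)

lemma hinge_sides:
  assumes "hinge p x y"
  shows "0 < dist p x" "dist p x < pi" "0 < dist p y" "dist p y < pi" "dist x y < pi"
  using assms dist_triangle[of p x y] dist_triangle[of p y x] dist_triangle[of x y p]
  by (auto simp: hinge_def dist_commute)

lemma abs_cos_model_le_1:
  assumes "hinge p x y"
  shows "\<bar>cos_model p x y\<bar> \<le> 1"
  unfolding cos_model_def
proof (rule abs_cos_angle_of_sides_le_1)
  show "\<bar>dist p x - dist p y\<bar> \<le> dist x y" "dist x y \<le> dist p x + dist p y"
    using dist_triangle[of p x y] dist_triangle[of p y x] dist_triangle[of x y p]
    by (auto simp: dist_commute)
qed (use assms hinge_sides[OF assms] in \<open>auto simp: hinge_def\<close>)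

lemma polar_comparison_triangle:
  assumes "hinge p x y"
  shows "comparison_triangle p x y (polar 0 0) (polar (dist p x) 0)
    (polar (dist p y) (arccos (cos_model p x y)))"
proof -
  note s = hinge_sides[OF assms]
  have "cos (dist x y) = cos (dist p x) * cos (dist p y)
      + sin (dist p x) * sin (dist p y) * cos_model p x y"
    unfolding cos_model_def using s by (intro law_of_cosines) auto
  then have "polar (dist p x) 0 \<bullet> polar (dist p y) (arccos (cos_model p x y)) = cos (dist x y)"
    using abs_cos_model_le_1[OF assms] by (simp add: inner_polar cos_arccos_abs)
  then show ?thesis
    using s
    by (auto simp: comparison_triangle_def polar_in_S2[unfolded mem_sphere_0]
        sphere_dist_def inner_polar arccos_cos dist_commute)
qed

text \<open>The law of cosines determines the angle from the sides, whichever comparison triangle is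
  chosen, and a comparison triangle exists. So the definite description denotes.\<close>

lemma model_angle_eq:
  assumes "hinge p x y"
  shows "model_angle p x y = arccos (cos_model p x y)"
  unfolding model_angle_def
proof (rule the_equality)
  have eq: "sphere_angle p' x' y' = arccos (cos_model p x y)"
    if "comparison_triangle p x y p' x' y'" for p' x' y'
    using that
    by (auto simp: comparison_triangle_def sphere_angle_eq cos_model_def sphere_dist_commute
        dist_commute)
  show "\<exists>p' x' y'. comparison_triangle p x y p' x' y' \<and> arccos (cos_model p x y) = sphere_angle p' x' y'"
    using polar_comparison_triangle[OF assms] eq by metis
  show "\<theta> = arccos (cos_model p x y)"
    if "\<exists>p' x' y'. comparison_triangle p x y p' x' y' \<and> \<theta> = sphere_angle p' x' y'" for \<theta>
    using that eq by blast
qed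

lemma is_geodesic_dist:
  assumes "is_geodesic c p x" "s \<in> {0..dist p x}"
  shows "dist p (c s) = s" "dist (c s) x = dist p x - s"
proof -
  have iso: "\<forall>s\<in>{0..dist p x}. \<forall>t\<in>{0..dist p x}. dist (c s) (c t) = \<bar>s - t\<bar>"
    and "c 0 = p" "c (dist p x) = x"
    using assms by (auto simp: is_geodesic_def)
  moreover have "dist (c 0) (c s) = \<bar>0 - s\<bar>" "dist (c s) (c (dist p x)) = \<bar>s - dist p x\<bar>"
    using iso assms(2) by fastforce+
  ultimately show "dist p (c s) = s" "dist (c s) x = dist p x - s"
    using assms(2) by simp_all
qed

lemma is_geodesic_initial:
  assumes "is_geodesic c p x" "s \<in> {0..dist p x}"
  shows "is_geodesic c p (c s)"
  using assms is_geodesic_dist[OF assms] by (auto simp: is_geodesic_def)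

lemma is_geodesic_reverse:
  assumes "is_geodesic c p x"
  shows "is_geodesic (\<lambda>s. c (dist p x - s)) x p"
  using assms by (auto simp: is_geodesic_def dist_commute)

lemma hinge_shorten:
  assumes "hinge p x y" "is_geodesic c p y" "0 < t" "t \<le> dist p y"
  shows "hinge p x (c t)"
proof -
  have "dist p (c t) = t" "dist (c t) y = dist p y - t"
    using assms is_geodesic_dist[of c p y t] by auto
  then show ?thesis
    using assms dist_triangle[of x "c t" y] by (auto simp: hinge_def dist_commute)
qed

text \<open>Model angles shrink with the hinge. Place \<open>p\<close> at the pole of the sphere. The point \<open>c t\<close>
  corresponds to the point of the comparison triangle with the same angle coordinate as the vertex of
  \<open>y\<close>, so the CAT(1) inequality says that \<open>dist x (c t)\<close> is at most the third side of the spherical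
  hinge with sides \<open>dist p x\<close>, \<open>t\<close> and the model angle of the large triangle.\<close>

lemma cos_model_shorten:
  fixes p x y :: "'a::cat1_space"
  assumes h: "hinge p x y" and c: "is_geodesic c p y" and t: "0 < t" "t \<le> dist p y"
  shows "cos_model p x y \<le> cos_model p x (c t)"
proof -
  define k where "k = cos_model p x y"
  define a b \<theta> where "a = dist p x" and "b = dist p y" and "\<theta> = arccos k"
  note s = hinge_sides[OF h]
  have cth: "cos \<theta> = k"
    using abs_cos_model_le_1[OF h] by (simp add: \<theta>_def k_def cos_arccos_abs)
  obtain c2 c3 where c2: "is_geodesic c2 y x" and c3: "is_geodesic c3 x p"
    using cat1_geodesic s by (metis dist_commute)
  have tri: "comparison_triangle p y x (polar 0 0) (polar b \<theta>) (polar a 0)"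
    using polar_comparison_triangle[OF h]
    by (auto simp: comparison_triangle_def a_def b_def \<theta>_def k_def sphere_dist_commute dist_commute)
  have "corresponds_on_side c p y (polar 0 0) (polar b \<theta>) (c t) (polar t \<theta>)"
    unfolding corresponds_on_side_def
  proof (intro bexI[of _ t] conjI)
    have "polar 0 0 = polar 0 \<theta>"
      by (simp add: polar_def)
    then show "sphere_dist (polar 0 0) (polar t \<theta>) = t"
      using sphere_dist_polar_same_ray[of 0 t \<theta>] t s by simp
    show "sphere_dist (polar t \<theta>) (polar b \<theta>) = dist p y - t"
      using sphere_dist_polar_same_ray[of t b \<theta>] t s by (simp add: b_def)
  qed (use t polar_in_S2 in auto)
  moreover have "corresponds_on_side c3 x p (polar a 0) (polar 0 0) x (polar a 0)"
    unfolding corresponds_on_side_def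
  proof (intro bexI[of _ 0] conjI)
    show "x = c3 0"
      using c3 by (simp add: is_geodesic_def)
    show "sphere_dist (polar a 0) (polar a 0) = 0"
      using sphere_dist_polar_same_ray[of a a 0] s by (simp add: a_def)
    show "sphere_dist (polar a 0) (polar 0 0) = dist x p - 0"
      using sphere_dist_polar_same_ray[of 0 a 0] s by (simp add: a_def sphere_dist_commute dist_commute)
  qed (use polar_in_S2 in auto)
  moreover have "dist p y + dist y x + dist x p < 2 * pi"
    using h by (simp add: hinge_def dist_commute)
  ultimately have le: "dist (c t) x \<le> sphere_dist (polar t \<theta>) (polar a 0)"
    using cat1_comparison[OF c c2 c3 _ tri] by blast
  have "sphere_dist (polar t \<theta>) (polar a 0) \<le> pi"
    using Cauchy_Schwarz_ineq2[of "polar t \<theta>" "polar a 0"] polar_in_S2[of t \<theta>] polar_in_S2[of a 0]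
    by (auto simp: sphere_dist_def abs_le_iff intro!: arccos_ubound)
  then have "cos (sphere_dist (polar t \<theta>) (polar a 0)) \<le> cos (dist (c t) x)"
    using le by (intro cos_monotone_0_pi_le) auto
  then have *: "cos a * cos t + sin a * sin t * k \<le> cos (dist x (c t))"
    by (simp add: cos_sphere_dist[OF polar_in_S2 polar_in_S2] inner_polar cth dist_commute mult_ac)
  have "dist p (c t) = t"
    using is_geodesic_dist[OF c] t by auto
  moreover have "sin a * sin t > 0"
    using s t by (simp add: a_def sin_gt_zero)
  ultimately show ?thesis
    using * by (simp add: cos_model_def[of p x "c t"] cos_angle_of_sides_def a_def[symmetric]
        k_def[symmetric] pos_le_divide_eq algebra_simps)
qed

section \<open>Angles between geodesics\<close>

lemma cos_model_antimono:
  fixes p x y :: "'a::cat1_space"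
  assumes "hinge p x y" and c: "is_geodesic c p x" and c': "is_geodesic c' p y"
    and "0 < s'" "s' \<le> s" "s \<le> dist p x" "0 < t'" "t' \<le> t" "t \<le> dist p y"
  shows "hinge p (c s) (c' t)" "cos_model p (c s) (c' t) \<le> cos_model p (c s') (c' t')"
proof -
  show h: "hinge p (c s) (c' t)"
    by (meson assms hinge_commute hinge_shorten less_le_trans)
  have d: "dist p (c s) = s" "dist p (c' t) = t"
    using assms is_geodesic_dist[OF c] is_geodesic_dist[OF c'] by auto
  have g: "is_geodesic c p (c s)" "is_geodesic c' p (c' t)"
    using assms by (auto intro!: is_geodesic_initial)
  have h': "hinge p (c s) (c' t')"
    using hinge_shorten[OF h g(2)] assms d by auto
  have "cos_model p (c s) (c' t) \<le> cos_model p (c s) (c' t')"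
    using cos_model_shorten[OF h g(2)] assms d by auto
  also have "\<dots> \<le> cos_model p (c s') (c' t')"
    using cos_model_shorten[of p "c' t'" "c s" c s'] h' g(1) assms d
    by (auto simp: hinge_commute cos_model_commute)
  finally show "cos_model p (c s) (c' t) \<le> cos_model p (c s') (c' t')" .
qed

text \<open>By monotonicity the infimum is the limit at the corner.\<close>

lemma tendsto_mono_corner:
  fixes f :: "real \<Rightarrow> real \<Rightarrow> real"
  assumes "0 < a" "0 < b"
    and mono: "\<And>s s' t t'. \<lbrakk>0 < s'; s' \<le> s; s \<le> a; 0 < t'; t' \<le> t; t \<le> b\<rbrakk> \<Longrightarrow> f s' t' \<le> f s t"
    and bound: "\<And>s t. \<lbrakk>0 < s; s \<le> a; 0 < t; t \<le> b\<rbrakk> \<Longrightarrow> l \<le> f s t \<and> f s t \<le> u"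
  shows "\<exists>m\<in>{l..u}. ((\<lambda>(s, t). f s t) \<longlongrightarrow> m) (at_right 0 \<times>\<^sub>F at_right 0)"
proof -
  define m where "m = (INF (s, t)\<in>{0<..a} \<times> {0<..b}. f s t)"
  have bdd: "bdd_below ((\<lambda>(s, t). f s t) ` ({0<..a} \<times> {0<..b}))"
    by (rule bdd_belowI2[of _ l]) (use bound in auto)
  have m_le: "m \<le> f s t" if "0 < s" "s \<le> a" "0 < t" "t \<le> b" for s t
    unfolding m_def using cINF_lower[OF bdd, of "(s, t)"] that by auto
  have ev: "\<forall>\<^sub>F z in at_right 0 \<times>\<^sub>F at_right 0. 0 < fst z \<and> fst z \<le> s \<and> 0 < snd z \<and> snd z \<le> t"
    if "0 < s" "0 < t" for s t :: real
  proof -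
    have "\<forall>\<^sub>F x in at_right 0. 0 < x \<and> x \<le> s" "\<forall>\<^sub>F x in at_right 0. 0 < x \<and> x \<le> t"
      using eventually_at_right_real[OF that(1)] eventually_at_right_real[OF that(2)]
      by (auto elim: eventually_mono)
    from eventually_prodI[OF this] show ?thesis
      by (rule eventually_mono) auto
  qed
  have "((\<lambda>(s, t). f s t) \<longlongrightarrow> m) (at_right 0 \<times>\<^sub>F at_right 0)"
  proof (rule order_tendstoI)
    fix y assume "y < m"
    show "\<forall>\<^sub>F z in at_right 0 \<times>\<^sub>F at_right 0. y < (case z of (s, t) \<Rightarrow> f s t)"
      using ev[OF \<open>0 < a\<close> \<open>0 < b\<close>] by (rule eventually_mono) (use m_le \<open>y < m\<close> in fastforce)
  next
    fix y assume "m < y"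
    then obtain s t where st: "0 < s" "s \<le> a" "0 < t" "t \<le> b" "f s t < y"
      unfolding m_def using cINF_less_iff[OF _ bdd, of y] assms(1,2) by fastforce
    show "\<forall>\<^sub>F z in at_right 0 \<times>\<^sub>F at_right 0. (case z of (s, t) \<Rightarrow> f s t) < y"
      using ev[OF \<open>0 < s\<close> \<open>0 < t\<close>] by (rule eventually_mono) (use mono st in fastforce)
  qed
  moreover have "l \<le> m"
    unfolding m_def using assms(1,2) bound by (intro cINF_greatest) auto
  moreover have "m \<le> u"
    using m_le[of a b] bound[of a b] assms(1,2) by linarith
  ultimately show ?thesis by auto
qed

text \<open>As model angles are monotone, their limit exists and \<open>geodesic_angle\<close>, defined through \<open>Lim\<close>,
  is its actual value. Any bound valid for all small hinges passes to it.\<close>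

lemma geodesic_angle_bounds:
  fixes p x y :: "'a::cat1_space"
  assumes h: "hinge p x y" and c: "is_geodesic c p x" and c': "is_geodesic c' p y"
    and k: "\<bar>k\<bar> \<le> 1"
    and le: "\<And>s t. \<lbrakk>0 < s; s \<le> dist p x; 0 < t; t \<le> dist p y\<rbrakk> \<Longrightarrow> cos_model p (c s) (c' t) \<le> k"
  shows "arccos k \<le> geodesic_angle c c'" "geodesic_angle c c' \<le> pi"
proof -
  have c0: "c 0 = p"
    using c by (simp add: is_geodesic_def)
  have eq: "model_angle (c 0) (c s) (c' t) = arccos (cos_model p (c s) (c' t))"
    and abs: "\<bar>cos_model p (c s) (c' t)\<bar> \<le> 1"
    if "0 < s" "s \<le> dist p x" "0 < t" "t \<le> dist p y" for s t
    using cos_model_antimono(1)[OF h c c', of s s t t] that model_angle_eq abs_cos_model_le_1 c0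
    by auto
  have "\<exists>m\<in>{arccos k..pi}. ((\<lambda>(s, t). model_angle (c 0) (c s) (c' t)) \<longlongrightarrow> m)
      (at_right 0 \<times>\<^sub>F at_right 0)"
  proof (rule tendsto_mono_corner[of "dist p x" "dist p y"])
    fix s s' t t' assume st: "0 < s'" "s' \<le> s" "s \<le> dist p x" "0 < t'" "t' \<le> t" "t \<le> dist p y"
    then have "cos_model p (c s) (c' t) \<le> cos_model p (c s') (c' t')"
      by (rule cos_model_antimono(2)[OF h c c'])
    then show "model_angle (c 0) (c s') (c' t') \<le> model_angle (c 0) (c s) (c' t)"
      using st eq[of s t] eq[of s' t'] abs[of s t] abs[of s' t'] by (simp add: arccos_le_mono)
  next
    fix s t assume st: "0 < s" "s \<le> dist p x" "0 < t" "t \<le> dist p y"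
    show "arccos k \<le> model_angle (c 0) (c s) (c' t) \<and> model_angle (c 0) (c s) (c' t) \<le> pi"
      using eq[OF st] abs[OF st] le[OF st] k by (auto simp: arccos_le_mono abs_le_iff intro!: arccos_ubound)
  qed (use hinge_sides[OF h] in auto)
  then obtain m where m: "m \<in> {arccos k..pi}"
    "((\<lambda>(s, t). model_angle (c 0) (c s) (c' t)) \<longlongrightarrow> m) (at_right 0 \<times>\<^sub>F at_right 0)"
    by blast
  then have "geodesic_angle c c' = m"
    unfolding geodesic_angle_def
    by (intro tendsto_Lim) (auto simp: prod_filter_eq_bot)
  then show "arccos k \<le> geodesic_angle c c'" "geodesic_angle c c' \<le> pi"
    using m by auto
qed

text \<open>First variation on the sphere. Consider a geodesic of length \<open>s + a\<close> and a point moving away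
  at unit speed from the point that divides it into \<open>s\<close> and \<open>a\<close>, with direction of cosine \<open>k\<close> towards
  the endpoint of the part \<open>a\<close>. The \<open>arccos\<close> is the distance from that endpoint at time \<open>t\<close>; its
  derivative at \<open>0\<close> is \<open>- k\<close>. If the distance from the other endpoint compensates this, so that the two
  distances keep the sum \<open>s + a\<close>, the moving point starts in a direction of cosine \<open>- k\<close> towards it.\<close>

lemma first_variation_limit:
  fixes a s k :: real
  assumes "0 < a" "a < pi" "0 < s" "s < pi"
  shows "((\<lambda>t. cos_angle_of_sides s t (s + a - arccos (cos a * cos t + sin a * sin t * k))) \<longlongrightarrow> - k)
    (at_right 0)"
proof -
  define N where "N = (\<lambda>t. cos (s + a - arccos (cos a * cos t + sin a * sin t * k)) - cos s * cos t)"
  have sa: "sin a > 0" "sin s > 0"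
    using assms by (auto intro: sin_gt_zero)
  have "cos a < cos 0" "cos pi < cos a"
    using assms by (intro cos_monotone_0_pi; simp)+
  then have ca: "-1 < cos a" "cos a < 1" by auto
  have acos: "arccos (cos a) = a"
    using assms by (simp add: arccos_cos)
  have sq: "sqrt (1 - (cos a)\<^sup>2) = sin a"
    using sa by (simp add: cos_squared_eq)
  have "(N has_real_derivative - (sin s * k)) (at 0)"
    unfolding N_def
    using ca sa
    by (auto intro!: derivative_eq_intros simp: acos sq sin_arccos_abs field_simps)
  then have "(N has_real_derivative - (sin s * k)) (at_right 0)"
    by (rule has_field_derivative_at_within)
  moreover have N0: "N 0 = 0"
    by (simp add: N_def acos)
  ultimately have 1: "((\<lambda>t. N t / t) \<longlongrightarrow> - (sin s * k)) (at_right 0)"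
    by (simp add: has_field_derivative_iff)
  have "(sin has_real_derivative 1) (at_right 0)"
    by (auto intro!: derivative_eq_intros)
  then have 2: "((\<lambda>t::real. sin t / t) \<longlongrightarrow> 1) (at_right 0)"
    by (simp add: has_field_derivative_iff)
  have "((\<lambda>t. (N t / t) / (sin s * (sin t / t))) \<longlongrightarrow> - (sin s * k) / (sin s * 1)) (at_right 0)"
    using sa by (intro tendsto_intros 1 2) auto
  moreover have "\<forall>\<^sub>F t in at_right 0. (N t / t) / (sin s * (sin t / t))
      = cos_angle_of_sides s t (s + a - arccos (cos a * cos t + sin a * sin t * k))"
    using eventually_at_right_less[of 0]
    by (rule eventually_mono) (auto simp: N_def cos_angle_of_sides_def)
  ultimately show ?thesis
    using sa by (simp add: filterlim_cong)
qed

text \<open>If \<open>p\<close> lies between \<open>x\<close> and \<open>e\<close>, the model angles at \<open>p\<close> from \<open>y\<close> to \<open>x\<close> and to \<open>e\<close> have a sum of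
  at least \<open>pi\<close>. To see this, let \<open>y\<close> move to \<open>p\<close> along the geodesic, keeping \<open>x\<close> and \<open>e\<close> fixed:
  the CAT(1) inequality bounds \<open>dist e (c' t)\<close> from above, so the triangle inequality bounds
  \<open>dist x (c' t)\<close> from below, and the first variation limit applies. The model angles from \<open>y\<close> to \<open>x\<close> only
  decrease during this motion.

  It is essential that \<open>x\<close> stays away from \<open>p\<close> while \<open>y\<close> approaches it. If both approached \<open>p\<close> at the
  same rate, the triangle inequality would yield a weaker bound.\<close>

lemma cos_model_opposite_le:
  fixes p x y e :: "'a::cat1_space"
  assumes xy: "hinge p x y" and c: "is_geodesic c p x" and c': "is_geodesic c' p y"
    and ey: "hinge p e y" and between: "dist x e = dist x p + dist p e"
  shows "cos_model p x y \<le> - cos_model p e y"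
proof -
  define s a k where "s = dist p x" and "a = dist p e" and "k = cos_model p e y"
  note sides = hinge_sides[OF xy] hinge_sides[OF ey]
  define h where "h = (\<lambda>t. arccos (cos a * cos t + sin a * sin t * k))"
  define R where "R = (\<lambda>t. cos_angle_of_sides s t (s + a - h t))"
  have lim: "(R \<longlongrightarrow> - k) (at_right 0)"
    unfolding R_def h_def using sides by (intro first_variation_limit) (auto simp: s_def a_def)
  have "cos_model p x y \<le> R t" if t: "0 < t" "t < dist p y" "s + t \<le> pi" "h t \<le> a + s" for t
  proof -
    have pt: "dist p (c' t) = t"
      using is_geodesic_dist[OF c'] t by auto
    have hx: "hinge p x (c' t)" and he: "hinge p e (c' t)"
      using hinge_shorten[OF xy c'] hinge_shorten[OF ey c'] t by auto
    have k_le: "k \<le> cos_model p e (c' t)"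
      unfolding k_def using cos_model_shorten[OF ey c'] t by auto
    have "sin a * sin t \<ge> 0"
      using sides t by (simp add: a_def sin_ge_zero)
    then have "cos a * cos t + sin a * sin t * k \<le> cos a * cos t + sin a * sin t * cos_model p e (c' t)"
      using k_le by (simp add: mult_left_mono)
    also have "\<dots> = cos (dist e (c' t))"
      using law_of_cosines[of a t "dist e (c' t)"] sides t pt
      by (simp add: cos_model_def a_def)
    finally have ct: "cos a * cos t + sin a * sin t * k \<le> cos (dist e (c' t))" .
    have k1: "\<bar>k\<bar> \<le> 1"
      unfolding k_def by (rule abs_cos_model_le_1[OF ey])
    have "cos (a + t) \<le> cos a * cos t + sin a * sin t * k"
      using k1 \<open>sin a * sin t \<ge> 0\<close> mult_left_mono[of "-1" k "sin a * sin t"]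
      by (simp add: cos_add abs_le_iff)
    then have "-1 \<le> cos a * cos t + sin a * sin t * k"
      by (meson cos_ge_minus_one order_trans)
    then have "arccos (cos (dist e (c' t))) \<le> h t"
      unfolding h_def using ct by (intro arccos_le_arccos) auto
    then have "dist e (c' t) \<le> h t"
      using hinge_sides[OF he] by (simp add: arccos_cos)
    then have "s + a - h t \<le> dist x (c' t)"
      using dist_triangle[of x e "c' t"] between
      by (simp add: s_def a_def dist_commute)
    moreover have "dist x (c' t) \<le> pi"
      using hinge_sides[OF hx] by simp
    ultimately have "cos (dist x (c' t)) \<le> cos (s + a - h t)"
      using t by (intro cos_monotone_0_pi_le) auto
    moreover have "sin s * sin t > 0"
      using sides t by (simp add: s_def sin_gt_zero)
    ultimately have "cos_model p x (c' t) \<le> R t"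
      unfolding R_def cos_model_def cos_angle_of_sides_def s_def[symmetric] pt
      by (intro divide_right_mono) auto
    then show ?thesis
      using cos_model_shorten[OF xy c'] t by (meson less_imp_le order_trans)
  qed
  moreover have "\<forall>\<^sub>F t in at_right 0. 0 < t \<and> t < dist p y \<and> s + t \<le> pi \<and> h t \<le> a + s"
  proof -
    have "\<forall>\<^sub>F t in at_right 0. 0 < t \<and> t < min (dist p y) (pi - s)"
      using eventually_at_right_real[of 0 "min (dist p y) (pi - s)"] sides
      by (auto simp: s_def)
    moreover have "\<forall>\<^sub>F t in at_right 0. h t < a + s"
    proof (rule order_tendstoD(2))
      have "-1 < cos a \<and> cos a < 1"
        using cos_monotone_0_pi[of 0 a] cos_monotone_0_pi[of a pi] sides by (simp add: a_def)
      then have "isCont h 0"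
        unfolding h_def by (auto intro!: continuous_intros isCont_o2[OF _ isCont_arccos])
      then show "(h \<longlongrightarrow> h 0) (at_right 0)"
        by (simp add: continuous_within filterlim_at_split isCont_def)
      show "h 0 < a + s"
        using sides by (simp add: h_def arccos_cos a_def s_def)
    qed
    ultimately show ?thesis
      by eventually_elim auto
  qed
  ultimately have "\<forall>\<^sub>F t in at_right 0. cos_model p x y \<le> R t"
    by (auto elim: eventually_mono)
  then show ?thesis
    unfolding k_def[symmetric] by (intro tendsto_lowerbound[OF lim]) auto
qed

section \<open>The turning angle of a pursuit\<close>

lemma concave_on_sin:
  assumes "convex S" "S \<subseteq> {0..pi}"
  shows "concave_on S sin"
proof (rule f''_le0_imp_concave)
  show "(sin has_real_derivative cos x) (at x)" for x :: real
    by (rule DERIV_sin)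
  show "(cos has_real_derivative - sin x) (at x)" for x :: real
    by (rule DERIV_cos)
  show "- sin x \<le> 0" if "x \<in> S" for x :: real
    using that assms by (auto simp: sin_ge_zero)
qed (rule assms)

text \<open>Since \<open>1 - cos \<alpha> = 2 * (sin (\<alpha> / 2))\<^sup>2\<close>, this is the chord bound
  \<open>sin x \<ge> 2 * x / pi\<close> on \<open>[0, pi / 2]\<close>, with equality at \<open>k = -1\<close>.\<close>

lemma arccos_squared_le:
  assumes "\<bar>k\<bar> \<le> 1"
  shows "(arccos k)\<^sup>2 \<le> pi\<^sup>2 / 2 * (1 - k)"
proof -
  define \<alpha> where "\<alpha> = arccos k"
  have \<alpha>: "0 \<le> \<alpha>" "\<alpha> \<le> pi" "cos \<alpha> = k"
    using assms by (auto simp: \<alpha>_def abs_le_iff cos_arccos_abs intro: arccos_lbound arccos_ubound)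
  have "(1 - \<alpha> / pi) * sin 0 + \<alpha> / pi * sin (pi / 2) \<le> sin ((1 - \<alpha> / pi) *\<^sub>R 0 + (\<alpha> / pi) *\<^sub>R (pi / 2))"
    using \<alpha> by (intro concave_onD[OF concave_on_sin[of "{0..pi}"]]) auto
  then have "\<alpha> / pi \<le> sin (\<alpha> / 2)"
    by simp
  then have "(\<alpha> / pi)\<^sup>2 \<le> (sin (\<alpha> / 2))\<^sup>2"
    using \<alpha> by (intro power_mono) auto
  also have "\<dots> = (1 - k) / 2"
    using cos_double_sin[of "\<alpha> / 2"] \<alpha> by simp
  finally show ?thesis
    by (simp add: power_divide field_simps \<alpha>_def)
qed

lemma abs_cos_diff_le: "\<bar>cos x - cos y\<bar> \<le> \<bar>x - y\<bar>" for x y :: real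
proof -
  have "\<bar>cos x - cos y\<bar> = 2 * \<bar>sin ((x + y) / 2)\<bar> * \<bar>sin ((y - x) / 2)\<bar>"
    by (simp add: cos_diff_cos abs_mult)
  also have "\<dots> \<le> 2 * 1 * \<bar>(y - x) / 2\<bar>"
    by (intro mult_mono abs_sin_x_le_abs_x) auto
  finally show ?thesis by simp
qed

text \<open>One step of the pursuit: \<open>p\<close>, \<open>v\<close>, \<open>w\<close> are consecutive positions of the pursuer and \<open>e\<close>, \<open>e'\<close>
  those of the evader while the pursuer is at \<open>p\<close> and \<open>v\<close>. Since \<open>v\<close> lies between \<open>p\<close> and \<open>e\<close>, the
  angle at \<open>v\<close> between \<open>p\<close> and \<open>w\<close> is at least \<open>pi - \<alpha>\<close>, where \<open>\<alpha>\<close> is the model angle at \<open>v\<close>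
  between \<open>e\<close> and \<open>e'\<close>. The sides \<open>a = dist v e\<close> and \<open>b = dist v e'\<close> satisfy
  \<open>b - a = D - (dist p e - dist v e')\<close>, while the opposite side is at most \<open>D\<close>. So the triangle is nearly degenerate, with \<open>\<alpha>\<close> near \<open>0\<close>, if the
  pursuer gains little.\<close>

lemma turning_angle_bound:
  fixes p v w e e' :: "'a::cat1_space"
  assumes D: "0 < D" "D < dist p e" "D \<le> dist v e'" "dist p e < pi" "dist e e' \<le> D"
    and g: "is_geodesic g p e" "v = g D"
    and g': "is_geodesic g' v e'" "w = g' D"
    and c: "is_geodesic c v p" and c': "is_geodesic c' v w"
  shows "0 \<le> pi - geodesic_angle c c'"
    and "(pi - geodesic_angle c c')\<^sup>2
      \<le> pi\<^sup>2 / 2 * (dist p e - dist v e') / (sin (dist p e - D) * sin (dist v e'))"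
proof -
  define a b where "a = dist v e" and "b = dist v e'"
  have pv: "dist p v = D" and a: "a = dist p e - D"
    using is_geodesic_dist[OF g(1), of D] D g by (auto simp: a_def)
  have vw: "dist v w = D"
    using is_geodesic_dist[OF g'(1), of D] D g' by auto
  have b: "b \<le> a + D"
    using dist_triangle[of v e' e] D by (simp add: a_def b_def)
  have h: "hinge v e e'"
    using D a b by (auto simp: hinge_def a_def b_def)
  define k where "k = cos_model v e e'"
  have k1: "\<bar>k\<bar> \<le> 1"
    unfolding k_def by (rule abs_cos_model_le_1[OF h])
  have hw: "hinge v e w" and kw: "k \<le> cos_model v e w"
    using hinge_shorten[OF h g'(1), of D] cos_model_shorten[OF h g'(1), of D] D g'
    by (auto simp: k_def)
  \<comment> \<open>The triangle with vertices \<open>v\<close>, \<open>p\<close>, \<open>w\<close> may have perimeter \<open>2 * pi\<close> or more if \<open>D \<ge> pi / 2\<close>; initial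
    pieces of length below \<open>pi / 2\<close> avoid this.\<close>
  define r where "r = min D 1"
  have r: "0 < r" "r \<le> D" "r \<le> dist v p" "r \<le> dist v w" "r < pi / 2"
    using D pv vw pi_gt3 by (auto simp: r_def dist_commute)
  have cr: "is_geodesic c v (c r)" "dist v (c r) = r" and c'r: "is_geodesic c' v (c' r)" "dist v (c' r) = r"
    using is_geodesic_initial[OF c] is_geodesic_initial[OF c'] is_geodesic_dist[OF c]
      is_geodesic_dist[OF c'] r by auto
  have hr: "hinge v (c r) (c' r)"
    using r cr c'r dist_triangle[of "c r" "c' r" v] by (auto simp: hinge_def dist_commute)
  have le: "cos_model v (c s) (c' t) \<le> - k" if "0 < s" "s \<le> r" "0 < t" "t \<le> r" for s t
  proof -
    have vs: "dist v (c s) = s" "dist (c s) p = D - s"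
      using is_geodesic_dist[OF c, of s] that r pv by (auto simp: dist_commute)
    have cs: "is_geodesic c v (c s)" and c't: "is_geodesic c' v (c' t)"
      using is_geodesic_initial[OF c, of s] is_geodesic_initial[OF c', of t] that r by auto
    have "dist (c s) e = dist (c s) v + dist v e"
    proof (rule antisym)
      show "dist (c s) v + dist v e \<le> dist (c s) e"
        using dist_triangle[of p e "c s"] vs a by (simp add: dist_commute a_def)
    qed (rule dist_triangle)
    then have "cos_model v (c s) (c' t) \<le> - cos_model v e (c' t)"
      using cos_model_antimono(1)[OF hr cr(1) c'r(1), of s s t t] that cr c'r
        hinge_shorten[OF hw c'] r
      by (intro cos_model_opposite_le[OF _ cs c't]) auto
    also have "\<dots> \<le> - k"
      using cos_model_shorten[OF hw c', of t] kw that r by auto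
    finally show ?thesis .
  qed
  have "arccos (- k) \<le> geodesic_angle c c'" and le_pi: "geodesic_angle c c' \<le> pi"
    using geodesic_angle_bounds[OF hr cr(1) c'r(1), of "- k"] k1 le cr(2) c'r(2) by auto
  then have defect: "pi - geodesic_angle c c' \<le> arccos k"
    using k1 by (simp add: arccos_minus abs_le_iff)
  show nonneg: "0 \<le> pi - geodesic_angle c c'"
    using le_pi by simp
  have s: "sin a * sin b > 0"
    using D a b by (intro mult_pos_pos sin_gt_zero) (auto simp: b_def)
  have "cos D \<le> cos (dist e e')"
    using D by (intro cos_monotone_0_pi_le) auto
  moreover have "cos (a - b) - cos D \<le> dist p e - b"
  proof -
    have "cos (a - b) - cos D \<le> \<bar>(b - a) - D\<bar>"
      using abs_cos_diff_le[of "b - a" D] cos_minus[of "b - a"] by simp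
    then show ?thesis
      using a b by simp
  qed
  ultimately have "cos (a - b) - cos (dist e e') \<le> dist p e - b"
    by simp
  moreover have "1 - k = (cos (a - b) - cos (dist e e')) / (sin a * sin b)"
    using s less_imp_neq[OF s]
    by (simp add: k_def cos_model_def cos_angle_of_sides_def cos_diff divide_simps
        a_def[symmetric] b_def[symmetric])
  ultimately have k_bound: "1 - k \<le> (dist p e - b) / (sin a * sin b)"
    using s by (simp add: divide_right_mono)
  have "(pi - geodesic_angle c c')\<^sup>2 \<le> (arccos k)\<^sup>2"
    using nonneg defect by (intro power_mono)
  also have "\<dots> \<le> pi\<^sup>2 / 2 * (1 - k)"
    by (rule arccos_squared_le[OF k1])
  also have "\<dots> \<le> pi\<^sup>2 / 2 * ((dist p e - b) / (sin a * sin b))"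
    using k_bound by (intro mult_left_mono) auto
  finally show "(pi - geodesic_angle c c')\<^sup>2
      \<le> pi\<^sup>2 / 2 * (dist p e - dist v e') / (sin (dist p e - D) * sin (dist v e'))"
    by (simp add: a b_def)
qed

lemma simple_pursuit_distances:
  assumes "simple_pursuit D P E" "D > 0"
  shows "dist (P i) (P (Suc i)) = D" "dist (P (Suc i)) (E (Suc i)) \<le> dist (P i) (E i)"
proof -
  obtain g where g: "is_geodesic g (P i) (E i)" "P (Suc i) = g D"
    and D: "D \<le> dist (P i) (E i)" "dist (E i) (E (Suc i)) \<le> D"
    using assms unfolding simple_pursuit_def by blast
  show "dist (P i) (P (Suc i)) = D"
    using is_geodesic_dist[OF g(1), of D] g D assms by auto
  show "dist (P (Suc i)) (E (Suc i)) \<le> dist (P i) (E i)"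
    using is_geodesic_dist[OF g(1), of D] g D assms dist_triangle[of "P (Suc i)" "E (Suc i)" "E i"]
    by auto
qed

theorem theorem13:
  fixes D :: real
    and P E :: "nat \<Rightarrow> 'a::cat1_space"
    and c :: "real \<Rightarrow> 'a"
  assumes "D > 0"
    and "evader_wins D P E"
    and "dist (P 0) (E 0) < pi"
    and "pursuit_curve D P c"
  shows "total_curvature D c \<in> O[at_top](\<lambda>t. t powr (1/2))"
proof -
  define L where "L = (\<lambda>i. dist (P i) (E i))"
  define defect where "defect =
    (\<lambda>i. pi - geodesic_angle (\<lambda>s. c (real i * D - s)) (\<lambda>s. c (real i * D + s)))"
  have pursuit: "simple_pursuit D P E" and gtD: "\<And>i. D < L i"
    using assms by (auto simp: evader_wins_def L_def)
  obtain l where l: "L \<longlonglongrightarrow> l" "D < l"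
    using assms by (auto simp: evader_wins_def L_def)
  note dists = simple_pursuit_distances[OF pursuit \<open>D > 0\<close>]
  have dec: "decseq L"
    using dists(2) by (auto simp: L_def decseq_Suc_iff)
  have L_ge: "l \<le> L i" for i
    by (rule decseq_ge[OF dec l(1)])
  have L_le: "L i \<le> L 0" for i
    using dec by (simp add: decseq_def)
  have L0: "L 0 < pi"
    using assms by (simp add: L_def)
  define m where "m = min (sin (l - D)) (sin (L 0))"
  have m: "m > 0"
    using l L_ge[of 0] L0 \<open>D > 0\<close> by (auto simp: m_def intro!: sin_gt_zero)
  \<comment> \<open>The concave function \<open>sin\<close> takes its minimum on an interval at an endpoint.\<close>
  have m_le: "m \<le> sin x" if "l - D \<le> x" "x \<le> L 0" for x
  proof -
    have "concave_on {l - D..L 0} sin"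
      using l L0 by (intro concave_on_sin) auto
    then show ?thesis
      unfolding m_def using that by (intro concave_on_ge_min) auto
  qed
  define K where "K = pi\<^sup>2 / (2 * m\<^sup>2)"
  have K: "K \<ge> 0"
    by (simp add: K_def)
  have step: "0 \<le> defect (Suc i)" "(defect (Suc i))\<^sup>2 \<le> K * (L i - L (Suc i))" for i
  proof -
    obtain g g' where g: "is_geodesic g (P i) (E i)" "P (Suc i) = g D"
      and g': "is_geodesic g' (P (Suc i)) (E (Suc i))" "P (Suc (Suc i)) = g' D"
      and e: "dist (E i) (E (Suc i)) \<le> D"
      using pursuit unfolding simple_pursuit_def by metis
    have c: "is_geodesic (\<lambda>s. c (real j * D + s)) (P j) (P (Suc j))" for j
      using assms by (auto simp: pursuit_curve_def)
    have reverse: "is_geodesic (\<lambda>s. c (real (Suc i) * D - s)) (P (Suc i)) (P i)"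
      using is_geodesic_reverse[OF c[of i]] dists(1)[of i] by (simp add: algebra_simps)
    have "0 \<le> defect (Suc i)"
      and b: "(defect (Suc i))\<^sup>2 \<le> pi\<^sup>2 / 2 * (L i - L (Suc i)) / (sin (L i - D) * sin (L (Suc i)))"
      unfolding defect_def L_def
      using gtD[of i] gtD[of "Suc i"] L_le[of i] L0
      by (intro turning_angle_bound[OF \<open>D > 0\<close> _ _ _ e g g' reverse c]; simp add: L_def)+
    then show "0 \<le> defect (Suc i)" by blast
    have "m * m \<le> sin (L i - D) * sin (L (Suc i))"
      using m L_ge[of i] L_ge[of "Suc i"] L_le[of i] L_le[of "Suc i"] \<open>D > 0\<close>
      by (intro mult_mono m_le order_trans[OF less_imp_le[OF m] m_le]) auto
    moreover have "0 \<le> L i - L (Suc i)"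
      using dists(2) by (simp add: L_def)
    moreover have mm: "0 < m * m"
      using m by simp
    moreover have "0 < sin (L i - D) * sin (L (Suc i))"
      using calculation by linarith
    ultimately have "pi\<^sup>2 / 2 * (L i - L (Suc i)) / (sin (L i - D) * sin (L (Suc i)))
        \<le> pi\<^sup>2 / 2 * (L i - L (Suc i)) / (m * m)"
      by (intro divide_left_mono mult_pos_pos[OF _ mm]) simp_all
    with b show "(defect (Suc i))\<^sup>2 \<le> K * (L i - L (Suc i))"
      by (simp add: K_def power2_eq_square)
  qed
  have sum_le: "(\<Sum>i<n. defect (Suc i)) \<le> sqrt (K * L 0) * sqrt (real n)" for n
  proof -
    have "(\<Sum>i<n. (defect (Suc i))\<^sup>2) \<le> (\<Sum>i<n. K * (L i - L (Suc i)))"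
      by (intro sum_mono step)
    also have "\<dots> = K * (L 0 - L n)"
      by (simp add: sum_lessThan_telescope' flip: sum_distrib_left)
    also have "\<dots> \<le> K * L 0"
      using K by (intro mult_left_mono) (auto simp: L_def)
    finally have "(\<Sum>i<n. (defect (Suc i))\<^sup>2) * real n \<le> K * L 0 * real n"
      by (intro mult_right_mono) auto
    moreover have "(\<Sum>i<n. defect (Suc i))\<^sup>2 \<le> (\<Sum>i<n. (defect (Suc i))\<^sup>2) * real n"
      using sum_squared_le_sum_of_squares[of "\<lambda>i. defect (Suc i)" "{..<n}"] by simp
    ultimately show ?thesis
      by (intro real_le_rsqrt[of _ "K * L 0 * real n", unfolded real_sqrt_mult[of "K * L 0"]]) simp
  qed
  have bound: "norm (total_curvature D c t) \<le> sqrt (K * L 0) / sqrt D * norm (t powr (1/2))"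
    if "t \<ge> 0" for t
  proof -
    define n where "n = nat \<lfloor>t / D\<rfloor>"
    define I where "I = {i. 0 < i \<and> real i * D < t}"
    have n: "real n \<le> t / D"
      using that \<open>D > 0\<close> by (simp add: n_def)
    have I: "I \<subseteq> Suc ` {..<n}"
    proof
      fix i assume "i \<in> I"
      then have "0 < i" "real i \<le> t / D"
        using \<open>D > 0\<close> by (auto simp: I_def field_simps)
      then have "i \<le> n"
        by (simp add: n_def le_nat_floor)
      with \<open>0 < i\<close> show "i \<in> Suc ` {..<n}"
        by (cases i) auto
    qed
    have tc: "total_curvature D c t = (\<Sum>i\<in>I. defect i)"
      by (simp add: total_curvature_def I_def defect_def)
    have "0 \<le> (\<Sum>i\<in>I. defect i)"
      using I step by (intro sum_nonneg) auto
    moreover have "(\<Sum>i\<in>I. defect i) \<le> (\<Sum>i\<in>Suc ` {..<n}. defect i)"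
      using I step by (intro sum_mono2) auto
    moreover have "(\<Sum>i\<in>Suc ` {..<n}. defect i) = (\<Sum>i<n. defect (Suc i))"
      by (simp add: sum.reindex)
    moreover have "sqrt (K * L 0) * sqrt (real n) \<le> sqrt (K * L 0) * sqrt (t / D)"
      using n K by (intro mult_left_mono) (auto simp: L_def)
    ultimately have "\<bar>total_curvature D c t\<bar> \<le> sqrt (K * L 0) * sqrt (t / D)"
      using sum_le[of n] tc by simp
    then show ?thesis
      using that by (simp add: real_sqrt_divide powr_half_sqrt)
  qed
  show ?thesis
    by (rule bigoI[OF eventually_mono[OF eventually_ge_at_top[of 0] bound]])
qed

end
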